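(* Let $\mathbb{L}$ be a Dedekind complete unital $f$-algebra. Assume that $\mathbb{L}$ satisfies the countable sup property and admits a $\sigma$-order continuous completely metrizable locally solid topology. Let $X$ be an $\mathbb{L}$-normed space such that every absolutely convergent series in $X$ converges. Then $X$ is complete.
   Context: The countable sup property: every subset of $\mathbb{L}$ which has a supremum has a countable subset with the same supremum. A linear topology on $\mathbb{L}$ is locally solid if $0$ has a base of solid neighbourhoods; it is $\sigma$-order continuous if $\lambda_n\downarrow0$ implies $\lambda_n\to0$ in the topology. An $\mathbb{L}$-normed space is an $\mathbb{L}$-module $X$ with a map $\|\cdot\|:X\to\mathbb{L}^+$ such that $\|x\|=0$ iff $x=0$, $\|\lambda x\|=|\lambda|\|x\|$ and $\|x+y\|\le\|x\|+\|y\|$ for all $x,y\in X$, $\lambda\in\mathbb{L}$. A net $(x_\alpha)$ in $X$ converges to $x$ if $\|x_\alpha-x\|$ order converges to $0$ in $\mathbb{L}$, i.e. there is a set $\mathcal{E}\subseteq\mathbb{L}^+$ with $\inf\mathcal{E}=0$ such that for every $\varepsilon\in\mathcal{E}$ there is $\alpha_\varepsilon$ with $\|x_\alpha-x\|\le\varepsilon$ for all $\alpha\ge\alpha_\varepsilon$. A net $(x_\alpha)$ is Cauchy if there is a set $\mathcal{E}\subseteq\mathbb{L}^+$ with $\inf\mathcal{E}=0$ such that for every $\varepsilon\in\mathcal{E}$ there is $\alpha_\varepsilon$ with $\|x_\alpha-x_\beta\|\le\varepsilon$ for all $\alpha,\beta\ge\alpha_\varepsilon$. $X$ is complete if every Cauchy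 net in $X$ converges. A series $\sum_kx_k$ in $X$ converges if its sequence of partial sums converges; it is absolutely convergent if $\sum_k\|x_k\|$ converges in order in $\mathbb{L}$. *)

theory Defs
  imports
    "HOL-Analysis.Analysis"
    "HOL-Library.Lattice_Algebras"
    "HOL-Library.Lub_Glb"
begin

section \<open>Unital $f$-algebras\<close>

text \<open>
  A real vector lattice with an associative bilinear product for which products of
  positive elements are positive, together with the $f$-algebra identity.  Commutativity
  and \<open>0 \<noteq> 1\<close> are not assumed.  Dedekind completeness is expressed by adding the class
  \<^class>\<open>conditionally_complete_lattice\<close>.
\<close>

class f_algebra = ordered_real_vector + real_algebra + lattice_ring +
  assumes inf_mult_right_eq_0: "inf a b = 0 \<Longrightarrow> 0 \<le> c \<Longrightarrow> inf (a * c) b = 0"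
    and inf_mult_left_eq_0: "inf a b = 0 \<Longrightarrow> 0 \<le> c \<Longrightarrow> inf (c * a) b = 0"

class unital_f_algebra = f_algebra + monoid_mult

definition countable_sup_property :: "'a::order itself \<Rightarrow> bool" where
  "countable_sup_property _ \<longleftrightarrow>
     (\<forall>(A::'a set) s. isLub UNIV A s \<longrightarrow> (\<exists>C\<subseteq>A. countable C \<and> isLub UNIV C s))"


section \<open>Topologies on vector lattices\<close>

definition linear_topology :: "'a::real_vector topology \<Rightarrow> bool" where
  "linear_topology T \<longleftrightarrow>
     topspace T = UNIV \<and>
     continuous_map (prod_topology T T) T (\<lambda>(x, y). x + y) \<and>
     continuous_map (prod_topology euclideanreal T) T (\<lambda>(r, x). r *\<^sub>R x)"

definition solid :: "'a::lattice_ab_group_add_abs set \<Rightarrow> bool" where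
  "solid S \<longleftrightarrow> (\<forall>x y. y \<in> S \<longrightarrow> \<bar>x\<bar> \<le> \<bar>y\<bar> \<longrightarrow> x \<in> S)"

text \<open>The solid neighbourhoods of zero are not required to be open.\<close>

definition locally_solid :: "'a::f_algebra topology \<Rightarrow> bool" where
  "locally_solid T \<longleftrightarrow>
     linear_topology T \<and>
     (\<forall>U. openin T U \<and> 0 \<in> U \<longrightarrow>
        (\<exists>V W. openin T W \<and> 0 \<in> W \<and> W \<subseteq> V \<and> V \<subseteq> U \<and> solid V))"

definition sigma_order_continuous :: "'a::f_algebra topology \<Rightarrow> bool" where
  "sigma_order_continuous T \<longleftrightarrow>
     (\<forall>l::nat \<Rightarrow> 'a. decseq l \<and> isGlb UNIV (range l) 0 \<longrightarrow> limitin T l 0 sequentially)"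


section \<open>Nets\<close>

text \<open>
  A net is a function on a directed set \<open>D\<close> preordered by \<open>le\<close>; sequences are nets
  on \<open>UNIV :: nat set\<close>.  Only the values of the function on \<open>D\<close> matter.
\<close>

definition directed_set :: "'i set \<Rightarrow> ('i \<Rightarrow> 'i \<Rightarrow> bool) \<Rightarrow> bool" where
  "directed_set D le \<longleftrightarrow>
     D \<noteq> {} \<and>
     (\<forall>a\<in>D. le a a) \<and>
     (\<forall>a\<in>D. \<forall>b\<in>D. \<forall>c\<in>D. le a b \<longrightarrow> le b c \<longrightarrow> le a c) \<and>
     (\<forall>a\<in>D. \<forall>b\<in>D. \<exists>c\<in>D. le a c \<and> le b c)"

definition order_converges ::
  "'i set \<Rightarrow> ('i \<Rightarrow> 'i \<Rightarrow> bool) \<Rightarrow> ('i \<Rightarrow> 'l::f_algebra) \<Rightarrow> 'l \<Rightarrow> bool" where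
  "order_converges D le f l \<longleftrightarrow>
     (\<exists>E\<subseteq>{0..}. isGlb UNIV E 0 \<and>
        (\<forall>e\<in>E. \<exists>a0\<in>D. \<forall>a\<in>D. le a0 a \<longrightarrow> \<bar>f a - l\<bar> \<le> e))"


section \<open>Normed spaces over a unital $f$-algebra\<close>

text \<open>
  The library's modules have commutative scalar rings with \<open>0 \<noteq> 1\<close>, so the module
  axioms are written out here.
\<close>

locale L_normed_space =
  fixes scale :: "'l::unital_f_algebra \<Rightarrow> 'x::ab_group_add \<Rightarrow> 'x"
    and nrm :: "'x \<Rightarrow> 'l"
  assumes scale_right_distrib: "scale l (x + y) = scale l x + scale l y"
    and scale_left_distrib: "scale (l + m) x = scale l x + scale m x"
    and scale_scale: "scale l (scale m x) = scale (l * m) x"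
    and scale_one: "scale 1 x = x"
    and nrm_nonneg: "0 \<le> nrm x"
    and nrm_eq_0_iff: "nrm x = 0 \<longleftrightarrow> x = 0"
    and nrm_scale: "nrm (scale l x) = \<bar>l\<bar> * nrm x"
    and nrm_triangle: "nrm (x + y) \<le> nrm x + nrm y"

definition net_converges ::
  "('x::ab_group_add \<Rightarrow> 'l::f_algebra) \<Rightarrow> 'i set \<Rightarrow> ('i \<Rightarrow> 'i \<Rightarrow> bool) \<Rightarrow> ('i \<Rightarrow> 'x) \<Rightarrow> 'x \<Rightarrow> bool" where
  "net_converges nrm D le x y \<longleftrightarrow> order_converges D le (\<lambda>a. nrm (x a - y)) 0"

definition net_Cauchy ::
  "('x::ab_group_add \<Rightarrow> 'l::f_algebra) \<Rightarrow> 'i set \<Rightarrow> ('i \<Rightarrow> 'i \<Rightarrow> bool) \<Rightarrow> ('i \<Rightarrow> 'x) \<Rightarrow> bool" where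
  "net_Cauchy nrm D le x \<longleftrightarrow>
     (\<exists>E\<subseteq>{0..}. isGlb UNIV E 0 \<and>
        (\<forall>e\<in>E. \<exists>a0\<in>D. \<forall>a\<in>D. \<forall>b\<in>D. le a0 a \<longrightarrow> le a0 b \<longrightarrow> nrm (x a - x b) \<le> e))"

text \<open>
  HOL cannot quantify over all index types inside a formula, so completeness carries
  the type \<open>'i\<close> of indices as a parameter.  Proved for a type variable \<open>'i\<close>, it covers
  nets over arbitrary directed sets.
\<close>

definition L_complete ::
  "'i itself \<Rightarrow> ('x::ab_group_add \<Rightarrow> 'l::f_algebra) \<Rightarrow> bool" where
  "L_complete _ nrm \<longleftrightarrow>
     (\<forall>(D::'i set) le x. directed_set D le \<and> net_Cauchy nrm D le x \<longrightarrow>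
        (\<exists>y. net_converges nrm D le x y))"

definition series_converges ::
  "('x::ab_group_add \<Rightarrow> 'l::f_algebra) \<Rightarrow> (nat \<Rightarrow> 'x) \<Rightarrow> bool" where
  "series_converges nrm x \<longleftrightarrow> (\<exists>s. net_converges nrm UNIV (\<le>) (\<lambda>n. \<Sum>k<n. x k) s)"

definition series_absolutely_convergent ::
  "('x::ab_group_add \<Rightarrow> 'l::f_algebra) \<Rightarrow> (nat \<Rightarrow> 'x) \<Rightarrow> bool" where
  "series_absolutely_convergent nrm x \<longleftrightarrow>
     (\<exists>s. order_converges UNIV (\<le>) (\<lambda>n. \<Sum>k<n. nrm (x k)) s)"

end

theory Submission
  imports Defs
begin

text \<open>
  The countable sup property reduces a Cauchy net to a Cauchy sequence \<open>y\<close> along increasing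
  indices with \<open>nrm (y n - y m) \<le> e m\<close> for \<open>m \<le> n\<close> and \<open>e\<close> decreasing to \<open>0\<close>.  As \<open>e\<close> tends
  to \<open>0\<close> in the complete topology, a subsequence of \<open>e\<close> is summable, which makes the telescoping
  series of the corresponding subsequence of \<open>y\<close> absolutely convergent.  Its limit is the limit
  of the net.
\<close>

section \<open>Infima and the countable inf property\<close>

lemma isGlb_UNIV_iff:
  "isGlb UNIV A m \<longleftrightarrow> (\<forall>a\<in>A. m \<le> a) \<and> (\<forall>z. (\<forall>a\<in>A. z \<le> a) \<longrightarrow> z \<le> m)"
  by (auto simp: isGlb_def greatestP_def isLb_def setle_def setge_def)

lemma isLub_UNIV_iff:
  "isLub UNIV A m \<longleftrightarrow> (\<forall>a\<in>A. a \<le> m) \<and> (\<forall>z. (\<forall>a\<in>A. a \<le> z) \<longrightarrow> m \<le> z)"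
  by (auto simp: isLub_def leastP_def isUb_def setle_def setge_def)

lemma isLub_uminus_iff:
  fixes m :: "'a::ordered_ab_group_add"
  shows "isLub UNIV (uminus ` A) (- m) \<longleftrightarrow> isGlb UNIV A m"
proof
  assume L: "isLub UNIV (uminus ` A) (- m)"
  have "z \<le> m" if "\<forall>a\<in>A. z \<le> a" for z
  proof -
    have "- m \<le> - z"
      using that by (intro isLub_le_isUb[OF L] isUb_UNIV_I) auto
    then show ?thesis by simp
  qed
  with L show "isGlb UNIV A m"
    unfolding isGlb_UNIV_iff isLub_UNIV_iff by simp
next
  assume G: "isGlb UNIV A m"
  have "- m \<le> z" if "\<forall>a\<in>A. - a \<le> z" for z
  proof -
    have "- z \<le> m"
      using G that unfolding isGlb_UNIV_iff by (metis minus_le_iff)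
    then show ?thesis by (simp add: minus_le_iff)
  qed
  with G show "isLub UNIV (uminus ` A) (- m)"
    unfolding isGlb_UNIV_iff isLub_UNIV_iff by simp
qed

text \<open>Negation swaps suprema and infima, so the countable sup property passes to infima; the
  sets that bound a Cauchy net have infimum 0.\<close>

lemma countable_inf_property:
  fixes A :: "'a::ordered_ab_group_add set"
  assumes "countable_sup_property TYPE('a)" "isGlb UNIV A m"
  obtains C where "C \<subseteq> A" "countable C" "isGlb UNIV C m"
proof -
  have "isLub UNIV (uminus ` A) (- m)"
    using assms(2) by (simp add: isLub_uminus_iff)
  then obtain B where B: "B \<subseteq> uminus ` A" "countable B" "isLub UNIV B (- m)"
    using assms(1) unfolding countable_sup_property_def by blast
  have BB: "B = uminus ` uminus ` B"
    by (simp add: image_image)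
  show thesis
  proof
    show "uminus ` B \<subseteq> A" using B(1) by auto
    show "countable (uminus ` B)" using B(2) by simp
    show "isGlb UNIV (uminus ` B) m" using B(3) by (subst (asm) BB) (simp add: isLub_uminus_iff)
  qed
qed

section \<open>Sequences and series in a metrizable linear topology\<close>

lemma (in Metric_space) MCauchy_geometric:
  assumes "\<And>k. s k \<in> M" "\<And>k. d (s k) (s (Suc k)) < (1/2) ^ k"
  shows "MCauchy s"
proof -
  \<comment> \<open>The bound is the exact sum of \<open>(1/2) ^ i\<close> over
    \<open>m \<le> i < m + j\<close>; keeping the subtracted term lets the induction close.\<close>
  have step: "d (s m) (s (m + j)) \<le> 2 * (1/2) ^ m - 2 * (1/2) ^ (m + j)" for m j
  proof (induction j)
    case (Suc j)
    have "d (s m) (s (m + Suc j)) \<le> d (s m) (s (m + j)) + d (s (m + j)) (s (Suc (m + j)))"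
      using triangle assms(1) by simp
    then show ?case
      using Suc assms(2)[of "m + j"] by simp
  qed (simp add: assms(1))
  show ?thesis
    unfolding MCauchy_def
  proof (intro conjI allI impI)
    fix e :: real assume "e > 0"
    \<comment> \<open>The geometric tail from \<open>N\<close> is at most
      \<open>2 * (1/2) ^ N < e / 2\<close>, and two such distances are joined through
      \<open>s N\<close>.\<close>
    then obtain N where N: "(1/2) ^ N < e / 4"
      using real_arch_pow_inv[of "e / 4" "1/2"] by auto
    have near: "d (s N) (s n) < e / 2" if "N \<le> n" for n
    proof -
      have "d (s N) (s n) \<le> 2 * (1/2) ^ N - 2 * (1/2) ^ n"
        using step[of N "n - N"] that by simp
      also have "\<dots> < e / 2"
      proof -
        have "(1/2 :: real) ^ n > 0" by simp
        then show ?thesis using N by linarith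
      qed
      finally show ?thesis .
    qed
    have "d (s n) (s n') < e" if "N \<le> n" "N \<le> n'" for n n'
      using triangle[of "s n" "s N" "s n'"] near[OF that(1)] near[OF that(2)] assms(1)
      by (simp add: commute)
    then show "\<exists>N. \<forall>n n'. N \<le> n \<longrightarrow> N \<le> n' \<longrightarrow> d (s n) (s n') < e"
      by blast
  qed (use assms(1) in auto)
qed

lemma limitin_add:
  assumes "linear_topology T" "limitin T f a F" "limitin T g b F"
  shows "limitin T (\<lambda>x. f x + g x) (a + b) F"
proof -
  have "limitin (prod_topology T T) (\<lambda>x. (f x, g x)) (a, b) F"
    using assms by (simp add: limitin_pairwise o_def)
  then show ?thesis
    using continuous_map_limit[of "prod_topology T T" T "\<lambda>(x, y). x + y"] assms(1)
    by (fastforce simp: linear_topology_def o_def)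
qed

text \<open>
  The compatible metric need not be translation invariant, so the next term is chosen
  small relative to the current partial sum rather than to \<open>0\<close>.
\<close>

lemma limitin_zero_imp_convergent_subseries:
  fixes e :: "nat \<Rightarrow> 'a::real_vector"
  assumes lin: "linear_topology T" and comp: "completely_metrizable_space T"
    and e: "limitin T e 0 sequentially"
  obtains r l where "strict_mono r" "limitin T (\<lambda>n. \<Sum>k<n. e (r k)) l sequentially"
proof -
  obtain M d where M: "Metric_space M d" "Metric_space.mcomplete M d"
    and T: "T = Metric_space.mtopology M d"
    using comp unfolding completely_metrizable_space_def by blast
  interpret Metric_space M d by fact
  have top: "M = UNIV"
    using lin T by (simp add: linear_topology_def)
  have small: "\<exists>n>m. d s (s + e n) < \<epsilon>" if "\<epsilon> > 0" for s m \<epsilon>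
  proof -
    have "limitin T (\<lambda>n. s + e n) s sequentially"
      using limitin_add[OF lin _ e, of "\<lambda>_. s" s] lin by (simp add: linear_topology_def)
    then have "\<forall>\<^sub>F n in sequentially. d (s + e n) s < \<epsilon>"
      using that unfolding T limitin_metric by (auto elim: eventually_mono)
    then have "\<forall>\<^sub>F n in sequentially. n > m \<and> d (s + e n) s < \<epsilon>"
      using eventually_gt_at_top[of m] by eventually_elim simp
    then show ?thesis
      by (auto simp: commute dest: eventually_happens'[OF sequentially_bot])
  qed
  \<comment> \<open>Each state \<open>f k\<close> pairs the index of the next term with the sum
    reached before that term is added.\<close>
  have "\<exists>f. \<forall>k. d (snd (f k)) (snd (f k) + e (fst (f k))) < (1/2) ^ k \<and>
      (fst (f (Suc k)) > fst (f k) \<and> snd (f (Suc k)) = snd (f k) + e (fst (f k)))"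
  proof (rule dependent_nat_choice)
    obtain n where "d 0 (0 + e n) < 1"
      using small[of 1 0 0] by auto
    then show "\<exists>p. d (snd p) (snd p + e (fst p)) < (1/2) ^ 0"
      by (intro exI[of _ "(n, 0)"]) simp
  next
    fix p :: "nat \<times> 'a" and k
    obtain n where "n > fst p" "d (snd p + e (fst p)) (snd p + e (fst p) + e n) < (1/2) ^ Suc k"
      using small[of "(1/2) ^ Suc k" "fst p" "snd p + e (fst p)"] by auto
    then show "\<exists>p'. d (snd p') (snd p' + e (fst p')) < (1/2) ^ Suc k \<and>
        (fst p' > fst p \<and> snd p' = snd p + e (fst p))"
      by (intro exI[of _ "(n, snd p + e (fst p))"]) simp
  qed
  then obtain f where "\<forall>k. d (snd (f k)) (snd (f k) + e (fst (f k))) < (1/2) ^ k \<and>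
      (fst (f (Suc k)) > fst (f k) \<and> snd (f (Suc k)) = snd (f k) + e (fst (f k)))" ..
  then have f: "d (snd (f k)) (snd (f k) + e (fst (f k))) < (1/2) ^ k"
      "fst (f (Suc k)) > fst (f k)" "snd (f (Suc k)) = snd (f k) + e (fst (f k))" for k
    by simp_all
  \<comment> \<open>The properties recorded for \<open>f\<close> leave the starting sum
    \<open>snd (f 0)\<close> open, hence the correction.\<close>
  have sum: "(\<Sum>k<n. e (fst (f k))) = - snd (f 0) + snd (f n)" for n
    by (induction n) (simp_all add: f(3))
  have "MCauchy (\<lambda>k. snd (f k))"
    using f(1) by (intro MCauchy_geometric) (simp_all add: top f(3))
  then obtain l where "limitin T (\<lambda>k. snd (f k)) l sequentially"
    using M(2) unfolding mcomplete_def T by blast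
  then have "limitin T (\<lambda>k. - snd (f 0) + snd (f k)) (- snd (f 0) + l) sequentially"
    using lin by (intro limitin_add) (simp_all add: linear_topology_def)
  then have "limitin T (\<lambda>n. \<Sum>k<n. e (fst (f k))) (- snd (f 0) + l) sequentially"
    by (simp only: sum)
  moreover have "strict_mono (\<lambda>k. fst (f k))"
    using f(2) by (simp add: strict_mono_Suc_iff)
  ultimately show thesis
    using that by blast
qed

section \<open>Order bounds and order limits of increasing sequences\<close>

text \<open>The positive part of \<open>s k - l\<close> is dominated by
  \<open>\<bar>s m - l\<bar>\<close> for every \<open>m \<ge> k\<close>. Solidity puts it in every
  neighbourhood of 0, and the Hausdorff property makes it 0.\<close>

lemma incseq_le_limitin:
  fixes s :: "nat \<Rightarrow> 'a::f_algebra"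
  assumes T: "locally_solid T" "Hausdorff_space T"
    and s: "incseq s" "limitin T s l sequentially"
  shows "s k \<le> l"
proof -
  have lin: "linear_topology T" and top: "topspace T = UNIV"
    using T(1) by (auto simp: locally_solid_def linear_topology_def)
  define w where "w = sup (s k - l) 0"
  have w0: "0 \<le> w"
    by (simp add: w_def)
  have diff: "limitin T (\<lambda>m. s m + (- l)) (l + (- l)) sequentially"
    using s(2) lin top by (intro limitin_add) simp_all
  have nhd: "w \<in> U" if U: "openin T U" "0 \<in> U" for U
  proof -
    obtain V W where VW: "openin T W" "0 \<in> W" "W \<subseteq> V" "V \<subseteq> U" "solid V"
      using T(1) U unfolding locally_solid_def by blast
    \<comment> \<open>The solid set \<open>V\<close> need not be open, so convergence is applied to
      the open \<open>W\<close> inside it.\<close>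
    have "\<forall>\<^sub>F m in sequentially. s m + (- l) \<in> W"
      using diff VW(1,2) by (simp add: limitin_def)
    then have "\<forall>\<^sub>F m in sequentially. k \<le> m \<and> s m - l \<in> W"
      using eventually_ge_at_top[of k] by eventually_elim simp
    then obtain m where m: "k \<le> m" "s m - l \<in> W"
      using eventually_happens'[OF sequentially_bot] by blast
    have "s k - l \<le> \<bar>s m - l\<bar>"
      using incseqD[OF s(1) m(1)] abs_ge_self[of "s m - l"]
      by (meson diff_right_mono order_trans)
    then have "w \<le> \<bar>s m - l\<bar>"
      by (simp add: w_def)
    then have "\<bar>w\<bar> \<le> \<bar>s m - l\<bar>"
      using w0 by simp
    then show ?thesis
      using VW m(2) unfolding solid_def by blast
  qed
  have "w = 0"
  proof (rule ccontr)
    assume "w \<noteq> 0"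
    then obtain U V where "openin T U" "openin T V" "w \<in> V" "0 \<in> U" "disjnt U V"
      using T(2) top unfolding Hausdorff_space_def by (metis UNIV_I)
    then show False
      using nhd by (meson disjnt_iff)
  qed
  then show ?thesis
    by (metis diff_le_0_iff_le sup.cobounded1 w_def)
qed

text \<open>The gaps between the supremum and the terms form the bounding set: each gap controls all
  later terms by monotonicity.\<close>

lemma order_converges_SUP:
  fixes s :: "nat \<Rightarrow> 'a::{f_algebra, conditionally_complete_lattice}"
  assumes "incseq s" "bdd_above (range s)"
  shows "order_converges UNIV (\<le>) s (SUP n. s n)"
proof -
  let ?S = "SUP n. s n"
  have le: "s n \<le> ?S" for n
    using assms(2) by (simp add: cSUP_upper)
  have "isGlb UNIV (range (\<lambda>n. ?S - s n)) 0"
    unfolding isGlb_UNIV_iff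
  proof (intro conjI allI impI)
    fix z assume "\<forall>a\<in>range (\<lambda>n. ?S - s n). z \<le> a"
    \<comment> \<open>A lower bound \<open>z\<close> of the gaps makes \<open>?S - z\<close> an
      upper bound of the sequence.\<close>
    then have "s n \<le> ?S - z" for n
      by (simp add: algebra_simps)
    then have "?S \<le> ?S - z"
      by (intro cSUP_least) auto
    then show "z \<le> 0"
      by simp
  qed (use le in auto)
  moreover have "\<bar>s m - ?S\<bar> \<le> ?S - s n" if "n \<le> m" for m n
    using incseqD[OF assms(1) that] le[of m]
    by (intro abs_leI) (auto simp: algebra_simps intro: add_mono order_trans)
  ultimately show ?thesis
    unfolding order_converges_def using le
    by (intro exI[of _ "range (\<lambda>n. ?S - s n)"]) auto
qed

section \<open>Cauchy sequences in the normed space\<close>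

lemma (in L_normed_space) nrm_diff_triangle: "nrm (x - z) \<le> nrm (x - y) + nrm (y - z)"
  using nrm_triangle[of "x - y" "y - z"] by simp

text \<open>
  If the terms \<open>e (r k)\<close> sum up in \<open>T\<close>, their partial sums are order bounded, so the
  increments \<open>nrm (y (r (k + 1)) - y (r k))\<close> form an order convergent series.
\<close>

lemma convergent_subsequence:
  fixes scale :: "'l::{unital_f_algebra, conditionally_complete_lattice} \<Rightarrow> 'x::ab_group_add \<Rightarrow> 'x"
    and nrm :: "'x \<Rightarrow> 'l" and T :: "'l topology" and e :: "nat \<Rightarrow> 'l" and y :: "nat \<Rightarrow> 'x"
  assumes T: "locally_solid T" "completely_metrizable_space T" "sigma_order_continuous T"
    and L: "L_normed_space scale nrm"
    and abs: "\<And>x. series_absolutely_convergent nrm x \<Longrightarrow> series_converges nrm x"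
    and e: "decseq e" "isGlb UNIV (range e) 0"
    and y: "\<And>m n. m \<le> n \<Longrightarrow> nrm (y n - y m) \<le> e m"
  obtains r :: "nat \<Rightarrow> nat" and z where "strict_mono r" "net_converges nrm UNIV (\<le>) (y \<circ> r) z"
proof -
  interpret L_normed_space scale nrm by fact
  have "limitin T e 0 sequentially"
    using T(3) e unfolding sigma_order_continuous_def by blast
  then obtain r :: "nat \<Rightarrow> nat" and l where r: "strict_mono r"
    and l: "limitin T (\<lambda>n. \<Sum>k<n. e (r k)) l sequentially"
    using limitin_zero_imp_convergent_subseries T(1,2) unfolding locally_solid_def by metis
  have e0: "0 \<le> e n" for n
    using e(2) unfolding isGlb_UNIV_iff by blast
  have Haus: "Hausdorff_space T"
    using T(2) completely_metrizable_imp_metrizable_space metrizable_imp_Hausdorff_space by blast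
  have "incseq (\<lambda>n. \<Sum>k<n. e (r k))"
    by (rule incseq_SucI) (simp add: e0)
  then have bound: "(\<Sum>k<n. e (r k)) \<le> l" for n
    using incseq_le_limitin[OF T(1) Haus _ l] by blast
  define x where "x k = y (r (Suc k)) - y (r k)" for k
  have "nrm (x k) \<le> e (r k)" for k
    unfolding x_def using r by (intro y) (simp add: strict_mono_less_eq)
  then have le: "(\<Sum>k<n. nrm (x k)) \<le> l" for n
    using bound[of n] by (meson order_trans sum_mono)
  \<comment> \<open>Dedekind completeness supplies this supremum, since \<open>l\<close> is an upper
    bound; it need not equal \<open>l\<close>.\<close>
  have "order_converges UNIV (\<le>) (\<lambda>n. \<Sum>k<n. nrm (x k)) (SUP n. \<Sum>k<n. nrm (x k))"
    by (rule order_converges_SUP) (auto intro!: incseq_SucI bdd_aboveI[of _ l] simp: nrm_nonneg le)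
  then obtain s where s: "net_converges nrm UNIV (\<le>) (\<lambda>n. \<Sum>k<n. x k) s"
    using abs unfolding series_absolutely_convergent_def series_converges_def by blast
  have "(\<Sum>k<n. x k) = y (r n) - y (r 0)" for n
    unfolding x_def by (rule sum_lessThan_telescope)
  then have "(\<Sum>k<n. x k) - s = (y \<circ> r) n - (s + y (r 0))" for n
    by (simp add: algebra_simps)
  then have "net_converges nrm UNIV (\<le>) (y \<circ> r) (s + y (r 0))"
    using s unfolding net_converges_def by (simp only:)
  then show thesis
    using that r by blast
qed

section \<open>Passage from nets to sequences\<close>

text \<open>Directedness allows \<open>a (Suc n)\<close> to be chosen above both \<open>a n\<close>
  and \<open>b (Suc n)\<close>. With the thresholds of a Cauchy net as \<open>b\<close>, the net can
  be sampled along an increasing sequence.\<close>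

lemma directed_set_sequence:
  fixes b :: "nat \<Rightarrow> 'i"
  assumes D: "directed_set D le" and b: "\<And>n. b n \<in> D"
  obtains a where "\<And>n. a n \<in> D" "\<And>n. le (b n) (a n)" "\<And>m n. m \<le> n \<Longrightarrow> le (a m) (a n)"
proof -
  have refl: "le u u" if "u \<in> D" for u
    using D that unfolding directed_set_def by blast
  have trans: "le u w" if "le u v" "le v w" "u \<in> D" "v \<in> D" "w \<in> D" for u v w
    using D that unfolding directed_set_def by blast
  have up: "\<exists>w\<in>D. le u w \<and> le v w" if "u \<in> D" "v \<in> D" for u v
    using D that unfolding directed_set_def by blast
  have "\<exists>a. \<forall>n. (a n \<in> D \<and> le (b n) (a n)) \<and> le (a n) (a (Suc n))"
  proof (rule dependent_nat_choice)
    show "\<exists>x. x \<in> D \<and> le (b 0) x"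
      using b refl by blast
    show "\<exists>x'. (x' \<in> D \<and> le (b (Suc n)) x') \<and> le x x'" if "x \<in> D \<and> le (b n) x" for x n
      using up[of x "b (Suc n)"] that b by blast
  qed
  then obtain a where a: "\<And>n. a n \<in> D" "\<And>n. le (b n) (a n)" "\<And>n. le (a n) (a (Suc n))"
    by blast
  have "le (a m) (a n)" if "m \<le> n" for m n
    using that
  proof (induction n rule: dec_induct)
    case base
    show ?case using a(1) refl by blast
  next
    case (step n)
    then show ?case using a trans by blast
  qed
  with a that show thesis
    by blast
qed

theorem theorem8p3:
  fixes scale :: "'l::{unital_f_algebra, conditionally_complete_lattice} \<Rightarrow> 'x::ab_group_add \<Rightarrow> 'x"
    and nrm :: "'x \<Rightarrow> 'l"
  assumes "countable_sup_property TYPE('l)"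
    and "\<exists>T::'l topology. locally_solid T \<and> completely_metrizable_space T \<and> sigma_order_continuous T"
    and "L_normed_space scale nrm"
    and "\<And>x. series_absolutely_convergent nrm x \<Longrightarrow> series_converges nrm x"
  shows "L_complete TYPE('i) nrm"
  unfolding L_complete_def
proof (intro allI impI, elim conjE)
  fix D :: "'i set" and le x
  assume D: "directed_set D le" and "net_Cauchy nrm D le x"
  then obtain E where E: "E \<subseteq> {0..}" "isGlb UNIV E 0"
    and Cauchy: "\<And>e. e \<in> E \<Longrightarrow> \<exists>a0\<in>D. \<forall>a\<in>D. \<forall>b\<in>D. le a0 a \<longrightarrow> le a0 b \<longrightarrow> nrm (x a - x b) \<le> e"
    unfolding net_Cauchy_def by blast
  interpret L_normed_space scale nrm by fact
  have trans: "le u w" if "le u v" "le v w" "u \<in> D" "v \<in> D" "w \<in> D" for u v w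
    using D that unfolding directed_set_def by blast
  obtain C where C: "C \<subseteq> E" "countable C" "isGlb UNIV C 0"
    using countable_inf_property[OF assms(1) E(2)] by blast
  show "\<exists>y. net_converges nrm D le x y"
  proof (cases "C = {}")
    case True
    \<comment> \<open>An infimum of the empty set only exists if \<open>'l\<close> is trivial.\<close>
    with C(3) show ?thesis
      unfolding net_converges_def order_converges_def by blast
  next
    case False
    \<comment> \<open>Repetitions are allowed, so a finite nonempty \<open>C\<close> is enumerated
      as well.\<close>
    define c where "c = from_nat_into C"
    have range_c: "range c = C"
      unfolding c_def using False C(2) by (rule range_from_nat_into)
    have c: "c n \<in> E" "0 \<le> c n" for n
      using range_c C(1) E(1) by (auto simp: subset_iff)
    have "\<forall>n. \<exists>a0\<in>D. \<forall>a\<in>D. \<forall>b\<in>D. le a0 a \<longrightarrow> le a0 b \<longrightarrow> nrm (x a - x b) \<le> c n"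
      using Cauchy c(1) by blast
    then obtain b where b: "\<And>n. b n \<in> D"
      "\<And>n u v. \<lbrakk>u \<in> D; v \<in> D; le (b n) u; le (b n) v\<rbrakk> \<Longrightarrow> nrm (x u - x v) \<le> c n"
      by metis
    obtain a where a: "\<And>n. a n \<in> D" "\<And>n. le (b n) (a n)" "\<And>m n. m \<le> n \<Longrightarrow> le (a m) (a n)"
      using directed_set_sequence[of D le b, OF D b(1)] by blast
    have a_c: "nrm (x u - x v) \<le> c n" if "u \<in> D" "v \<in> D" "le (a n) u" "le (a n) v" for n u v
      using that b a trans by meson
    \<comment> \<open>Running infima make the bounds decreasing, and \<open>e n \<le> c n\<close>
      keeps their infimum at 0.\<close>
    define e where "e n = (INF i\<in>{..n}. c i)" for n
    have bdd: "bdd_below (c ` {..n})" for n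
      using c(2) by (intro bdd_belowI[of _ 0]) auto
    have e_c: "e n \<le> c i" if "i \<le> n" for i n
      unfolding e_def using that bdd by (intro cINF_lower) auto
    have e_greatest: "w \<le> e n" if "\<And>i. i \<le> n \<Longrightarrow> w \<le> c i" for w n
      unfolding e_def using that by (intro cINF_greatest) auto
    have "decseq e"
      by (intro decseq_SucI e_greatest e_c) simp
    moreover have "isGlb UNIV (range e) 0"
      unfolding isGlb_UNIV_iff
    proof (intro conjI allI impI)
      fix w assume "\<forall>u\<in>range e. w \<le> u"
      then have "\<forall>u\<in>C. w \<le> u"
        using e_c order_trans unfolding range_c[symmetric] by blast
      then show "w \<le> 0"
        using C(3) unfolding isGlb_UNIV_iff by blast
    qed (use e_greatest c(2) in auto)
    \<comment> \<open>For each \<open>i \<le> m\<close> both indices lie beyond \<open>a i\<close>,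
      so all of \<open>c 0\<close>, ..., \<open>c m\<close> bound the norm.\<close>
    moreover have "nrm (x (a n) - x (a m)) \<le> e m" if "m \<le> n" for m n
      using that a(1,3) by (intro e_greatest a_c) auto
    ultimately obtain r :: "nat \<Rightarrow> nat" and z where r: "strict_mono r"
      and z: "net_converges nrm UNIV (\<le>) ((\<lambda>n. x (a n)) \<circ> r) z"
      using assms(2) convergent_subsequence[OF _ _ _ assms(3,4), of _ e "\<lambda>n. x (a n)"] by metis
    obtain F where F: "isGlb UNIV F 0"
      and lim: "\<And>\<epsilon>. \<epsilon> \<in> F \<Longrightarrow> \<exists>k. \<forall>n\<ge>k. nrm (x (a (r n)) - z) \<le> \<epsilon>"
      using z unfolding net_converges_def order_converges_def by (auto simp: nrm_nonneg)
    \<comment> \<open>Passing through a late term of the subsequence costs \<open>c n\<close> plus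
      some \<epsilon> in \<open>F\<close>; as \<open>F\<close> has infimum 0, only
      \<open>c n\<close> remains. Thus \<open>C\<close> also bounds the convergence of the net, with
      thresholds \<open>a n\<close>.\<close>
    have "nrm (x u - z) \<le> c n" if u: "u \<in> D" "le (a n) u" for n u
    proof -
      have "nrm (x u - z) - c n \<le> \<epsilon>" if \<epsilon>: "\<epsilon> \<in> F" for \<epsilon>
      proof -
        obtain k where k: "\<And>m. m \<ge> k \<Longrightarrow> nrm (x (a (r m)) - z) \<le> \<epsilon>"
          using lim[OF \<epsilon>] by blast
        \<comment> \<open>\<open>m \<ge> k\<close> gives closeness to \<open>z\<close>;
          \<open>r m \<ge> m \<ge> n\<close> puts \<open>a (r m)\<close> beyond
          \<open>a n\<close>.\<close>
        define m where "m = max k n"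
        have "n \<le> r m"
          using strict_mono_imp_increasing[OF r, of m] by (simp add: m_def)
        then have "nrm (x u - x (a (r m))) \<le> c n"
          using u a by (intro a_c) auto
        moreover have "nrm (x (a (r m)) - z) \<le> \<epsilon>"
          by (rule k) (simp add: m_def)
        ultimately have "nrm (x u - z) \<le> c n + \<epsilon>"
          using nrm_diff_triangle order_trans add_mono by meson
        then show ?thesis
          by (simp add: algebra_simps)
      qed
      then have "nrm (x u - z) - c n \<le> 0"
        using F unfolding isGlb_UNIV_iff by blast
      then show ?thesis
        by simp
    qed
    then have "\<forall>e\<in>C. \<exists>a0\<in>D. \<forall>u\<in>D. le a0 u \<longrightarrow> \<bar>nrm (x u - z) - 0\<bar> \<le> e"
      unfolding range_c[symmetric] using a(1) by (auto simp: nrm_nonneg)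
    then show ?thesis
      unfolding net_converges_def order_converges_def using C E by blast
  qed
qed

end
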